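(* For every finite group $G$, $$\mathbf{Solv}(G)\le\mathbf{Fit}(G)\le\mathbf{Der}(G)\le\mathbf{cx}(G).$$
   Context: All groups are finite. Functions $\mathbf{c}$ go from the class of finite groups to $\mathbb{N}=\{0,1,2,\dots\}$. The complexity axioms for $\mathbf{c}$ are the following five. (Extension) If $N\lhd G$, then $\mathbf{c}(G)\le \mathbf{c}(N)+\mathbf{c}(G/N)$. (Quotient) If there is a surjective homomorphism $G\to H$, then $\mathbf{c}(G)\ge \mathbf{c}(H)$. (Constructability) Every group $G$ has a subnormal series $\mathbf{1}=G_n\lhd G_{n-1}\lhd\cdots\lhd G_0=G$ (some $n\ge 0$) with $\mathbf{c}(G_i/G_{i+1})\le 1$ for all $0\le i<n$. (Product) If $G=H\times K$, then $\mathbf{c}(G)=\max(\mathbf{c}(H),\mathbf{c}(K))$. (Initial condition) $\mathbf{c}(\mathbf{1})=0$ for the trivial group $\mathbf{1}$. A complexity function is a function satisfying these five axioms. $\mathbf{cx}$ denotes the unique maximal (pointwise largest) complexity function on finite groups, $\mathbf{cx}(G)=\sup\{\mathbf{c}(G):\mathbf{c}\text{ a complexity function}\}$. $\mathbf{Der}(G)$ (respectively $\mathbf{Fit}(G)$, $\mathbf{Solv}(G)$) is the length of a shortest subnormal series from $\mathbf{1}$ to $G$ such that each successive quotient is a direct product of an abelian (respectively nilpotent, solvable) group and zero or more finite simple non-abelian groups; the abelian, nilpotent or solvable factor may be trivial. *)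

theory Defs
  imports "HOL-Algebra.Algebra"
begin

definition subnormal_series :: "('a, 'b) monoid_scheme \<Rightarrow> (nat \<Rightarrow> 'a set) \<Rightarrow> nat \<Rightarrow> bool" where
  "subnormal_series G s n \<longleftrightarrow>
     s 0 = carrier G \<and> s n = {\<one>\<^bsub>G\<^esub>} \<and> (\<forall>i<n. s (Suc i) \<lhd> G\<lparr>carrier := s i\<rparr>)"

abbreviation series_quotient :: "('a, 'b) monoid_scheme \<Rightarrow> (nat \<Rightarrow> 'a set) \<Rightarrow> nat \<Rightarrow> 'a set monoid" where
  "series_quotient G s i \<equiv> (G\<lparr>carrier := s i\<rparr>) Mod s (Suc i)"


text \<open>
  HOL has no type of all finite groups. Every finite group is isomorphic to one whose carrier
  consists of natural numbers, so a function \<open>c\<close> on the class of finite groups is given by its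
  values on the finite groups of type \<open>nat monoid\<close>. Its value \<open>at_group c G\<close> on a
  finite group \<open>G\<close> over any type (a quotient, a direct product) is the value of \<open>c\<close> at an
  isomorphic copy of \<open>G\<close>. The quotient axiom below makes \<open>c\<close> invariant under isomorphism, so the
  choice of copy is immaterial (lemma \<open>at_group_eq\<close>).
\<close>

definition nat_copy :: "('a, 'b) monoid_scheme \<Rightarrow> nat monoid" where
  "nat_copy G = (SOME H. group H \<and> finite (carrier H) \<and> G \<cong> H)"

definition at_group :: "(nat monoid \<Rightarrow> nat) \<Rightarrow> ('a, 'b) monoid_scheme \<Rightarrow> nat" where
  "at_group c G = c (nat_copy G)"

definition extension_axiom :: "(nat monoid \<Rightarrow> nat) \<Rightarrow> bool" where
  "extension_axiom c \<longleftrightarrow>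
     (\<forall>G N. group G \<and> finite (carrier G) \<and> N \<lhd> G \<longrightarrow>
        c G \<le> c (G\<lparr>carrier := N\<rparr>) + at_group c (G Mod N))"

definition quotient_axiom :: "(nat monoid \<Rightarrow> nat) \<Rightarrow> bool" where
  "quotient_axiom c \<longleftrightarrow>
     (\<forall>G H. group G \<and> finite (carrier G) \<and> group H \<and> finite (carrier H) \<and> epi G H \<noteq> {} \<longrightarrow>
        c H \<le> c G)"

definition constructability_axiom :: "(nat monoid \<Rightarrow> nat) \<Rightarrow> bool" where
  "constructability_axiom c \<longleftrightarrow>
     (\<forall>G :: nat monoid. group G \<and> finite (carrier G) \<longrightarrow>
        (\<exists>s n. subnormal_series G s n \<and> (\<forall>i<n. at_group c (series_quotient G s i) \<le> 1)))"

definition product_axiom :: "(nat monoid \<Rightarrow> nat) \<Rightarrow> bool" where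
  "product_axiom c \<longleftrightarrow>
     (\<forall>H K. group H \<and> finite (carrier H) \<and> group K \<and> finite (carrier K) \<longrightarrow>
        at_group c (H \<times>\<times> K) = max (c H) (c K))"

definition initial_condition :: "(nat monoid \<Rightarrow> nat) \<Rightarrow> bool" where
  "initial_condition c \<longleftrightarrow> (\<forall>G. group G \<and> carrier G = {\<one>\<^bsub>G\<^esub>} \<longrightarrow> c G = 0)"

definition complexity_function :: "(nat monoid \<Rightarrow> nat) \<Rightarrow> bool" where
  "complexity_function c \<longleftrightarrow>
     extension_axiom c \<and> quotient_axiom c \<and> constructability_axiom c \<and>
     product_axiom c \<and> initial_condition c"

text \<open>
  For finite \<open>G\<close> the supremum is over a nonempty bounded set: the zero function is a complexity
  function, and by the extension, constructability and initial axioms \<open>c\<close> is at most the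
  number of nontrivial quotients of some subnormal series of \<open>G\<close>.
\<close>

definition cx :: "('a, 'b) monoid_scheme \<Rightarrow> nat" where
  "cx G = Sup {at_group c G | c. complexity_function c}"


primrec lower_central_series :: "('a, 'b) monoid_scheme \<Rightarrow> nat \<Rightarrow> 'a set" where
  "lower_central_series G 0 = carrier G"
| "lower_central_series G (Suc n) = generate G
     (\<Union>x\<in>carrier G. \<Union>y\<in>lower_central_series G n.
        {x \<otimes>\<^bsub>G\<^esub> y \<otimes>\<^bsub>G\<^esub> inv\<^bsub>G\<^esub> x \<otimes>\<^bsub>G\<^esub> inv\<^bsub>G\<^esub> y})"

definition nilpotent :: "('a, 'b) monoid_scheme \<Rightarrow> bool" where
  "nilpotent G \<longleftrightarrow> (\<exists>n. lower_central_series G n = {\<one>\<^bsub>G\<^esub>})"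

text \<open>
  \<open>Q\<close> is the direct product of a group with property \<open>P\<close> and \<open>k \<ge> 0\<close> finite simple non-abelian
  groups. Up to isomorphism the factors can be taken of type \<open>nat monoid\<close>, as \<open>Q\<close> is
  only used for finite groups.
\<close>

definition product_with_simples :: "(nat monoid \<Rightarrow> bool) \<Rightarrow> ('a, 'b) monoid_scheme \<Rightarrow> bool" where
  "product_with_simples P Q \<longleftrightarrow>
     (\<exists>A k S. group A \<and> P A \<and>
        (\<forall>i<k. simple_group (S i) \<and> finite (carrier (S i)) \<and> \<not> comm_group (S i)) \<and>
        Q \<cong> A \<times>\<times> product_group {..<k} (S :: nat \<Rightarrow> nat monoid))"

text \<open>
  Every finite group has such a series whenever \<open>P\<close> holds for all abelian groups, namely a
  composition series, so the minimum below exists in the three cases considered.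
\<close>

definition shortest_series :: "(nat monoid \<Rightarrow> bool) \<Rightarrow> ('a, 'b) monoid_scheme \<Rightarrow> nat" where
  "shortest_series P G =
     (LEAST n. \<exists>s. subnormal_series G s n \<and> (\<forall>i<n. product_with_simples P (series_quotient G s i)))"

definition Der :: "('a, 'b) monoid_scheme \<Rightarrow> nat" where
  "Der G = shortest_series comm_group G"

definition Fit :: "('a, 'b) monoid_scheme \<Rightarrow> nat" where
  "Fit G = shortest_series nilpotent G"

definition Solv :: "('a, 'b) monoid_scheme \<Rightarrow> nat" where
  "Solv G = shortest_series solvable G"


lemma nat_copy:
  assumes "group G" "finite (carrier G)"
  shows "group (nat_copy G) \<and> finite (carrier (nat_copy G)) \<and> G \<cong> nat_copy G"
proof -
  obtain f :: "'a \<Rightarrow> nat" where f: "inj_on f (carrier G)"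
    using finite_imp_inj_to_nat_seg[OF assms(2)] by blast
  define g where "g = inv_into (carrier G) f"
  define H :: "nat monoid" where
    "H = \<lparr>carrier = f ` carrier G, monoid.mult = (\<lambda>x y. f (g x \<otimes>\<^bsub>G\<^esub> g y)), monoid.one = f \<one>\<^bsub>G\<^esub>\<rparr>"
  have "f \<in> iso G H"
    using f by (auto simp: iso_def hom_def H_def g_def bij_betw_def)
  moreover from this have "group H"
  proof -
    have "f \<one>\<^bsub>G\<^esub> = \<one>\<^bsub>H\<^esub>" by (simp add: H_def)
    with group.iso_imp_img_group[OF assms(1) \<open>f \<in> iso G H\<close>] show ?thesis by simp
  qed
  ultimately have "group H \<and> finite (carrier H) \<and> G \<cong> H"
    using assms(2) by (auto simp: H_def is_iso_def)
  then show ?thesis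
    unfolding nat_copy_def by (rule someI)
qed

lemma at_group_eq:
  assumes "quotient_axiom c" "group G" "finite (carrier G)"
    and "group H" "finite (carrier H)" "G \<cong> H"
  shows "at_group c G = c H"
proof -
  note copy = nat_copy[OF assms(2,3)]
  have 1: "H \<cong> nat_copy G"
    using copy assms(2,6) group.iso_sym iso_trans by blast
  then have 2: "nat_copy G \<cong> H"
    using assms(4) group.iso_sym by blast
  have epi: "epi K L \<noteq> {}" if "K \<cong> L" for K L :: "nat monoid"
    using that iso_iff_mon_epi unfolding is_iso_def by blast
  show ?thesis
    unfolding at_group_def
    using assms(1,4,5) copy epi[OF 1] epi[OF 2] unfolding quotient_axiom_def
    by (meson le_antisym)
qed

end

theory Submission
  imports Defs
begin

text \<open>
  The first two inequalities hold because abelian groups are nilpotent and nilpotent groups are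
  solvable. For the third, \<open>Der\<close> is itself a complexity function: preimages, images and products
  of series are series, and products of an abelian group with non-abelian simple groups are
  closed under direct products and quotients. For quotients one removes the simple factors one at a
  time: the kernel of a surjection from \<open>H \<times>\<times> T\<close> with \<open>T\<close> simple non-abelian either contains \<open>T\<close>, or
  lies in \<open>H\<close> because \<open>T\<close> has trivial centre, and then \<open>T\<close> splits off the image. The supremum
  defining \<open>cx G\<close> is bounded since every complexity function is at most the order of the group.
\<close>

section \<open>Isomorphisms, epimorphisms and rearrangements of direct products\<close>

lemma iso_symmetric: "group G \<Longrightarrow> G \<cong> H \<Longrightarrow> H \<cong> G"
  by (rule group.iso_sym)

lemma epi_of_iso: "G \<cong> H \<Longrightarrow> \<exists>f. f \<in> epi G H"
  using iso_iff_mon_epi unfolding is_iso_def by blast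

lemma epi_group_hom: "f \<in> epi G H \<Longrightarrow> group G \<Longrightarrow> group H \<Longrightarrow> group_hom G H f"
  by (simp add: epi_def group_hom_def group_hom_axioms_def)

lemma epi_finite: "f \<in> epi G H \<Longrightarrow> finite (carrier G) \<Longrightarrow> finite (carrier H)"
  unfolding epi_def by (metis (mono_tags, lifting) finite_imageI mem_Collect_eq)

lemma comm_group_epi:
  assumes "comm_group G" "group H" "f \<in> epi G H"
  shows "comm_group H"
proof (rule group.group_comm_groupI[OF assms(2)])
  interpret G: comm_group G by fact
  fix x y assume "x \<in> carrier H" "y \<in> carrier H"
  then obtain a b where "a \<in> carrier G" "b \<in> carrier G" "x = f a" "y = f b"
    using assms(3) unfolding epi_def by blast
  then show "x \<otimes>\<^bsub>H\<^esub> y = y \<otimes>\<^bsub>H\<^esub> x"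
    using assms(3) G.m_comm[of a b] unfolding epi_def by (metis (mono_tags, lifting) hom_mult mem_Collect_eq)
qed

lemma comm_group_iso: "comm_group G \<Longrightarrow> group H \<Longrightarrow> G \<cong> H \<Longrightarrow> comm_group H"
  using comm_group_epi epi_of_iso by blast

lemma simple_group_iso: "simple_group G \<Longrightarrow> group H \<Longrightarrow> G \<cong> H \<Longrightarrow> simple_group H"
  using simple_group.iso_simple unfolding is_iso_def by blast

lemma trivial_comm_group: "group G \<Longrightarrow> carrier G = {\<one>\<^bsub>G\<^esub>} \<Longrightarrow> comm_group G"
  by (rule group.group_comm_groupI) auto

lemma comm_group_DirProd:
  assumes "comm_group G" "comm_group H"
  shows "comm_group (G \<times>\<times> H)"
proof -
  interpret G: comm_group G by fact
  interpret H: comm_group H by fact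
  show ?thesis
    by (rule group.group_comm_groupI)
       (auto intro: DirProd_group G.is_group H.is_group G.m_comm H.m_comm)
qed

lemma DirProd_swap_inner_iso: "(G \<times>\<times> H) \<times>\<times> K \<cong> (G \<times>\<times> K) \<times>\<times> H"
  by (rule is_isoI[where h = "\<lambda>((x, y), z). ((x, z), y)"])
     (auto simp: iso_def hom_def bij_betw_def inj_on_def image_def)

lemma DirProd_assoc_left_iso: "G \<times>\<times> (H \<times>\<times> K) \<cong> (G \<times>\<times> H) \<times>\<times> K"
  by (rule is_isoI[where h = "\<lambda>(x, (y, z)). ((x, y), z)"])
     (auto simp: iso_def hom_def bij_betw_def inj_on_def image_def)

lemma DirProd_assoc_right_iso: "(G \<times>\<times> H) \<times>\<times> K \<cong> G \<times>\<times> (H \<times>\<times> K)"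
  by (rule is_isoI[where h = "\<lambda>((x, y), z). (x, (y, z))"])
     (auto simp: iso_def hom_def bij_betw_def inj_on_def image_def)

lemma DirProd_trivial_iso:
  assumes "group G" "group H" "carrier H = {\<one>\<^bsub>H\<^esub>}"
  shows "G \<cong> G \<times>\<times> H"
proof (rule is_isoI[where h = "\<lambda>x. (x, \<one>\<^bsub>H\<^esub>)"])
  interpret H: group H by fact
  show "(\<lambda>x. (x, \<one>\<^bsub>H\<^esub>)) \<in> iso G (G \<times>\<times> H)"
    using assms(3) by (auto simp: iso_def hom_def bij_betw_def inj_on_def image_def)
qed

text \<open>Splitting off the last coordinate lets inductions on the number of simple factors handle
  one factor at a time.\<close>

lemma product_group_Suc_iso:
  fixes S :: "nat \<Rightarrow> ('a, 'b) monoid_scheme"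
  shows "product_group {..<Suc k} S \<cong> product_group {..<k} S \<times>\<times> S k"
proof (rule is_isoI)
  let ?h = "\<lambda>x :: nat \<Rightarrow> 'a. (restrict x {..<k}, x k)"
  have hom: "?h \<in> hom (product_group {..<Suc k} S) (product_group {..<k} S \<times>\<times> S k)"
    by (auto simp: hom_def PiE_iff fun_eq_iff)
  have "inj_on ?h (carrier (product_group {..<Suc k} S))"
  proof (rule inj_onI)
    fix x y
    assume xy: "x \<in> carrier (product_group {..<Suc k} S)" "y \<in> carrier (product_group {..<Suc k} S)"
      and eq: "?h x = ?h y"
    show "x = y"
    proof (rule PiE_ext)
      show "x \<in> (\<Pi>\<^sub>E i\<in>{..<Suc k}. carrier (S i))" "y \<in> (\<Pi>\<^sub>E i\<in>{..<Suc k}. carrier (S i))"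
        using xy by auto
      fix i assume "i \<in> {..<Suc k}"
      then consider "i < k" | "i = k" by (auto simp: less_Suc_eq)
      then show "x i = y i"
      proof cases
        case 1
        then have "restrict x {..<k} i = restrict y {..<k} i" using eq by (metis prod.inject)
        then show ?thesis using 1 by simp
      qed (use eq in simp)
    qed
  qed
  moreover have "?h ` carrier (product_group {..<Suc k} S) = carrier (product_group {..<k} S \<times>\<times> S k)"
  proof (intro equalityI subsetI)
    fix p assume "p \<in> ?h ` carrier (product_group {..<Suc k} S)"
    then show "p \<in> carrier (product_group {..<k} S \<times>\<times> S k)"
      using hom by (auto simp: hom_def)
  next
    fix p assume "p \<in> carrier (product_group {..<k} S \<times>\<times> S k)"
    then obtain x y where p: "p = (x, y)" "x \<in> (\<Pi>\<^sub>E i\<in>{..<k}. carrier (S i))" "y \<in> carrier (S k)"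
      by auto
    then have "x(k := y) \<in> carrier (product_group {..<Suc k} S)"
      by (auto simp: PiE_iff extensional_def)
    moreover have "p = ?h (x(k := y))"
      using p(1) PiE_restrict[OF p(2)] restrict_upd[of k "{..<k}" x y] by simp
    ultimately show "p \<in> ?h ` carrier (product_group {..<Suc k} S)"
      by blast
  qed
  ultimately show "?h \<in> iso (product_group {..<Suc k} S) (product_group {..<k} S \<times>\<times> S k)"
    using hom by (simp add: iso_def bij_betw_def)
qed

text \<open>An equality of records and not just an isomorphism: \<open>product_group\<close>
  restricts its unit and its products to the index set, so values of the family outside
  \<open>I\<close> leave no trace.\<close>

lemma product_group_cong:
  "(\<And>i. i \<in> I \<Longrightarrow> S i = T i) \<Longrightarrow> product_group I S = product_group I T"
  by (auto simp: product_group_def fun_eq_iff restrict_def cong: PiE_cong)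

section \<open>Products of an abelian group with non-abelian simple groups\<close>

lemma product_with_simples_iso:
  "Q \<cong> Q' \<Longrightarrow> product_with_simples P Q' \<Longrightarrow> product_with_simples P Q"
  unfolding product_with_simples_def by (meson iso_trans)

lemma product_with_simples_comm_group:
  assumes "comm_group Q" "finite (carrier Q)"
  shows "product_with_simples comm_group Q"
proof -
  interpret Q: comm_group Q by fact
  \<comment> \<open>No simple factors are taken; the product over the empty index set is the trivial
    group.\<close>
  let ?A = "nat_copy Q" and ?E = "product_group {..<0::nat} (\<lambda>_. nat_copy Q)"
  have A: "group ?A" "Q \<cong> ?A" using nat_copy[OF Q.is_group assms(2)] by auto
  have "?A \<cong> ?A \<times>\<times> ?E"
    by (rule DirProd_trivial_iso) (use A in \<open>simp_all add: restrict_def\<close>)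
  then have "Q \<cong> ?A \<times>\<times> ?E" using A iso_trans by blast
  moreover have "comm_group ?A" using comm_group_iso assms(1) A by blast
  ultimately show ?thesis unfolding product_with_simples_def using A by blast
qed

text \<open>A copy of \<open>T\<close> on the naturals is appended to the family at the free index
  \<open>k\<close>, and associativity regroups the factors.\<close>

lemma product_with_simples_DirProd_simple:
  assumes H: "product_with_simples comm_group H" and gH: "group H"
    and T: "simple_group T" "finite (carrier T)" "\<not> comm_group T"
  shows "product_with_simples comm_group (H \<times>\<times> T)"
proof -
  obtain A :: "nat monoid" and k and S :: "nat \<Rightarrow> nat monoid" where A: "group A" "comm_group A"
    and S: "\<forall>i<k. simple_group (S i) \<and> finite (carrier (S i)) \<and> \<not> comm_group (S i)"
    and iso: "H \<cong> A \<times>\<times> product_group {..<k} S"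
    using H unfolding product_with_simples_def by blast
  have gT: "group T" using T(1) by (rule simple_group.axioms(1))
  note copy = nat_copy[OF gT T(2)]
  define S' where "S' = S(k := nat_copy T)"
  have "simple_group (nat_copy T)" using simple_group_iso T copy by blast
  moreover have "\<not> comm_group (nat_copy T)"
    using comm_group_iso iso_symmetric[OF gT] T copy gT by blast
  ultimately have S': "\<forall>i<Suc k. simple_group (S' i) \<and> finite (carrier (S' i)) \<and> \<not> comm_group (S' i)"
    using S copy by (auto simp: S'_def less_Suc_eq)
  have PG: "product_group {..<k} S' = product_group {..<k} S"
    by (rule product_group_cong) (simp add: S'_def)
  have gS: "group (product_group {..<Suc k} S')"
    using S' simple_group.axioms(1) by (intro product_group) blast
  have "H \<times>\<times> T \<cong> (A \<times>\<times> product_group {..<k} S) \<times>\<times> nat_copy T"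
    using group.DirProd_iso_trans[OF gH] iso copy by blast
  also have "\<dots> \<cong> A \<times>\<times> (product_group {..<k} S \<times>\<times> nat_copy T)"
    by (rule DirProd_assoc_right_iso)
  also have "A \<times>\<times> (product_group {..<k} S \<times>\<times> nat_copy T) = A \<times>\<times> (product_group {..<k} S' \<times>\<times> S' k)"
    using PG by (simp add: S'_def)
  also have "A \<times>\<times> (product_group {..<k} S' \<times>\<times> S' k) \<cong> A \<times>\<times> product_group {..<Suc k} S'"
    using group.DirProd_iso_trans[OF A(1) iso_refl] iso_symmetric[OF gS] product_group_Suc_iso by blast
  finally show ?thesis
    unfolding product_with_simples_def using A S' by blast
qed

lemma product_with_simples_simple:
  assumes "simple_group T" "finite (carrier T)"
  shows "product_with_simples comm_group T"
proof (cases "comm_group T")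
  case True
  then show ?thesis using product_with_simples_comm_group assms by blast
next
  case False
  interpret T: simple_group T by fact
  \<comment> \<open>The trivial subgroup serves as the abelian factor, and \<open>T\<close> is
    attached to it.\<close>
  define E where "E = T\<lparr>carrier := {\<one>\<^bsub>T\<^esub>}\<rparr>"
  have E: "group E" "carrier E = {\<one>\<^bsub>E\<^esub>}"
    using T.triv_subgroup T.is_group unfolding E_def by (auto intro: subgroup.subgroup_is_group)
  have "finite (carrier E)" by (simp add: E_def)
  then have "product_with_simples comm_group E"
    using E trivial_comm_group product_with_simples_comm_group by blast
  then have "product_with_simples comm_group (E \<times>\<times> T)"
    by (rule product_with_simples_DirProd_simple)
       (use E False assms in auto)
  moreover have "T \<cong> E \<times>\<times> T"
    using DirProd_trivial_iso[OF T.is_group E] DirProd_commute_iso iso_trans by blast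
  ultimately show ?thesis using product_with_simples_iso by blast
qed

section \<open>Closure of these products under epimorphic images and direct products\<close>

text \<open>The centre \<open>Z\<close> is normal, hence trivial or the whole group, and the latter
  would make the group commutative.\<close>

lemma (in simple_group) central_trivial:
  assumes nc: "\<not> comm_group G" and z: "z \<in> carrier G"
    and central: "\<And>t. t \<in> carrier G \<Longrightarrow> z \<otimes> t = t \<otimes> z"
  shows "z = \<one>"
proof -
  define Z where "Z = {x \<in> carrier G. \<forall>t \<in> carrier G. x \<otimes> t = t \<otimes> x}"
  have Z_carrier: "x \<in> carrier G" if "x \<in> Z" for x
    using that unfolding Z_def by blast
  have Z_comm: "x \<otimes> t = t \<otimes> x" if "x \<in> Z" "t \<in> carrier G" for x t
    using that unfolding Z_def by blast
  have Z_I: "x \<in> Z" if "x \<in> carrier G" "\<And>t. t \<in> carrier G \<Longrightarrow> x \<otimes> t = t \<otimes> x" for x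
    using that unfolding Z_def by blast
  have "subgroup Z G"
  proof (rule subgroupI)
    show "Z \<subseteq> carrier G" using Z_carrier by blast
    show "Z \<noteq> {}" using Z_I[of \<one>] by auto
  next
    fix x assume x: "x \<in> Z"
    note xc = Z_carrier[OF x]
    show "inv x \<in> Z"
    proof (rule Z_I)
      fix t assume t: "t \<in> carrier G"
      have "inv x \<otimes> t \<otimes> x = inv x \<otimes> (x \<otimes> t)" using xc t by (simp add: m_assoc Z_comm[OF x t])
      also have "\<dots> = t" using xc t by (simp flip: m_assoc)
      finally show "inv x \<otimes> t = t \<otimes> inv x" using xc t by (subst inv_solve_right) simp_all
    qed (use xc in simp)
  next
    fix x y assume x: "x \<in> Z" and y: "y \<in> Z"
    note xy = Z_carrier[OF x] Z_carrier[OF y]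
    show "x \<otimes> y \<in> Z"
    proof (rule Z_I)
      fix t assume t: "t \<in> carrier G"
      have "x \<otimes> y \<otimes> t = x \<otimes> t \<otimes> y" using xy t by (simp add: m_assoc Z_comm[OF y t])
      also have "\<dots> = t \<otimes> (x \<otimes> y)" using xy t by (simp add: Z_comm[OF x t] m_assoc)
      finally show "x \<otimes> y \<otimes> t = t \<otimes> (x \<otimes> y)" .
    qed (use xy in simp)
  qed
  moreover have "x \<otimes> h \<otimes> inv x \<in> Z" if "x \<in> carrier G" "h \<in> Z" for x h
  proof -
    have "x \<otimes> h \<otimes> inv x = h \<otimes> x \<otimes> inv x" using Z_comm[OF that(2,1)] by simp
    also have "\<dots> = h" using that Z_carrier by (simp add: m_assoc)
    finally show ?thesis using that by simp
  qed
  ultimately have "Z \<lhd> G" by (rule normal_invI)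
  then have "Z = carrier G \<or> Z = {\<one>}" by (rule no_real_normal_subgroup)
  moreover have "Z \<noteq> carrier G"
    using nc group_comm_groupI unfolding Z_def by blast
  ultimately show ?thesis using Z_I[OF z central] by blast
qed

text \<open>One inductive step of closure under quotients. \<open>IH\<close> speaks only of groups
  of the type of \<open>K\<close>: it is applied either to \<open>K\<close> itself or to the image
  of \<open>H\<close>, a subgroup of \<open>K\<close>.\<close>

lemma product_with_simples_epi_DirProd_simple:
  fixes H :: "('a, 'b) monoid_scheme" and T :: "('c, 'd) monoid_scheme" and K :: "('e, 'f) monoid_scheme"
  assumes gH: "group H" and gK: "group K" and fin: "finite (carrier K)"
    and T: "simple_group T" "finite (carrier T)" "\<not> comm_group T"
    and f: "f \<in> epi (H \<times>\<times> T) K"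
    and IH: "\<And>(L :: ('e, 'f) monoid_scheme) g. \<lbrakk>group L; finite (carrier L); g \<in> epi H L\<rbrakk> \<Longrightarrow>
      product_with_simples comm_group L"
  shows "product_with_simples comm_group K"
proof -
  interpret H: group H by fact
  interpret T: simple_group T by fact
  interpret f: group_hom "H \<times>\<times> T" K f
    using f gK DirProd_group[OF gH T.is_group] by (intro epi_group_hom)
  have surj: "f ` (carrier H \<times> carrier T) = carrier K"
    using f by (simp add: epi_def)
  \<comment> \<open>The restrictions of \<open>f\<close> to the two factors; their images commute
    elementwise, and the products of their elements fill \<open>K\<close>.\<close>
  define a where "a = (\<lambda>x. f (x, \<one>\<^bsub>T\<^esub>))"
  define b where "b = (\<lambda>y. f (\<one>\<^bsub>H\<^esub>, y))"
  have a_hom: "a \<in> hom H K"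
    unfolding a_def hom_def using f.hom_mult[of "(_, \<one>\<^bsub>T\<^esub>)" "(_, \<one>\<^bsub>T\<^esub>)"] by auto
  have b_hom: "b \<in> hom T K"
    unfolding b_def hom_def using f.hom_mult[of "(\<one>\<^bsub>H\<^esub>, _)" "(\<one>\<^bsub>H\<^esub>, _)"] by auto
  interpret a: group_hom H K a using a_hom by unfold_locales
  interpret b: group_hom T K b using b_hom by unfold_locales
  have f_eq: "f (x, y) = a x \<otimes>\<^bsub>K\<^esub> b y" if "x \<in> carrier H" "y \<in> carrier T" for x y
    unfolding a_def b_def using that f.hom_mult[of "(x, \<one>\<^bsub>T\<^esub>)" "(\<one>\<^bsub>H\<^esub>, y)"]
      f.hom_mult[of "(\<one>\<^bsub>H\<^esub>, y)" "(x, \<one>\<^bsub>T\<^esub>)"] by simp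
  have comm: "a x \<otimes>\<^bsub>K\<^esub> b y = b y \<otimes>\<^bsub>K\<^esub> a x" if "x \<in> carrier H" "y \<in> carrier T" for x y
    unfolding a_def b_def using that f.hom_mult[of "(x, \<one>\<^bsub>T\<^esub>)" "(\<one>\<^bsub>H\<^esub>, y)"]
      f.hom_mult[of "(\<one>\<^bsub>H\<^esub>, y)" "(x, \<one>\<^bsub>T\<^esub>)"] by simp
  have "kernel T K b = carrier T \<or> kernel T K b = {\<one>\<^bsub>T\<^esub>}"
    using T.no_real_normal_subgroup b.normal_kernel by blast
  then show ?thesis
  proof
    \<comment> \<open>Here \<open>f\<close> factors through \<open>H\<close>, so \<open>a\<close>
      alone is onto.\<close>
    assume "kernel T K b = carrier T"
    then have f_a: "f (x, y) = a x" if "x \<in> carrier H" "y \<in> carrier T" for x y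
      using f_eq[OF that] that unfolding kernel_def by auto
    have "carrier K \<subseteq> a ` carrier H"
    proof
      fix z assume "z \<in> carrier K"
      then obtain x y where "x \<in> carrier H" "y \<in> carrier T" "z = f (x, y)"
        unfolding surj[symmetric] by (elim imageE SigmaE) auto
      then show "z \<in> a ` carrier H" using f_a by simp
    qed
    then have "a \<in> epi H K"
      using a_hom by (simp add: epi_iff_subset)
    then show ?thesis using IH gK fin by blast
  next
    assume ker_b: "kernel T K b = {\<one>\<^bsub>T\<^esub>}"
    \<comment> \<open>If \<open>(x, y)\<close> is in the kernel then \<open>y\<close> commutes with \<open>T\<close> modulo the trivial kernel of \<open>b\<close>.\<close>
    have ker_f: "y = \<one>\<^bsub>T\<^esub>" if x: "x \<in> carrier H" and y: "y \<in> carrier T" and 1: "a x \<otimes>\<^bsub>K\<^esub> b y = \<one>\<^bsub>K\<^esub>" for x y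
    proof (rule T.central_trivial[OF T(3) y])
      fix t assume t: "t \<in> carrier T"
      \<comment> \<open>Thus \<open>b y\<close> lies in the image of \<open>a\<close>, which
        commutes with \<open>b t\<close>.\<close>
      have by_eq: "b y = inv\<^bsub>K\<^esub> a x"
        using 1 comm[OF x y] x y by (metis a.hom_closed b.hom_closed f.H.inv_equality)
      have "b y \<otimes>\<^bsub>K\<^esub> b t = b t \<otimes>\<^bsub>K\<^esub> b y"
        unfolding by_eq using comm[of "inv\<^bsub>H\<^esub> x" t] x t by simp
      then have "b (y \<otimes>\<^bsub>T\<^esub> t) = b (t \<otimes>\<^bsub>T\<^esub> y)" using y t by simp
      moreover have "inj_on b (carrier T)"
        using ker_b b.inj_iff_trivial_ker by blast
      ultimately show "y \<otimes>\<^bsub>T\<^esub> t = t \<otimes>\<^bsub>T\<^esub> y"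
        using y t by (meson T.m_closed inj_onD)
    qed
    define L where "L = K\<lparr>carrier := a ` carrier H\<rparr>"
    have sub: "subgroup (a ` carrier H) K" by (rule a.img_is_subgroup)
    have L: "group L" "finite (carrier L)"
      using subgroup.subgroup_is_group[OF sub gK] fin subgroup.subset[OF sub] finite_subset
      unfolding L_def by auto
    have "a \<in> epi H L"
      using a_hom unfolding L_def epi_def hom_def by auto
    then have "product_with_simples comm_group L" using IH L by blast
    then have prod: "product_with_simples comm_group (L \<times>\<times> T)"
      using product_with_simples_DirProd_simple L T by blast
    \<comment> \<open>Multiplication inside \<open>K\<close>, with \<open>T\<close> standing for its
      image under \<open>b\<close>; it is a homomorphism since the two images commute, and injective
      by \<open>ker_f\<close>.\<close>
    define h where "h = (\<lambda>(u, y). u \<otimes>\<^bsub>K\<^esub> b y)"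
    have h_hom: "h \<in> hom (L \<times>\<times> T) K"
    proof (rule homI)
      fix p q assume "p \<in> carrier (L \<times>\<times> T)" "q \<in> carrier (L \<times>\<times> T)"
      then obtain x y x' y' where p: "p = (a x, y)" "q = (a x', y')" "x \<in> carrier H" "y \<in> carrier T"
        "x' \<in> carrier H" "y' \<in> carrier T" unfolding L_def by auto
      have "a x' \<otimes>\<^bsub>K\<^esub> (b y \<otimes>\<^bsub>K\<^esub> b y') = b y \<otimes>\<^bsub>K\<^esub> (a x' \<otimes>\<^bsub>K\<^esub> b y')"
        using comm[of x' y] p by (simp flip: f.H.m_assoc)
      then show "h (p \<otimes>\<^bsub>L \<times>\<times> T\<^esub> q) = h p \<otimes>\<^bsub>K\<^esub> h q"
        using p by (simp add: h_def L_def f.H.m_assoc)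
    qed (auto simp: h_def L_def)
    have ker_h: "kernel (L \<times>\<times> T) K h = {\<one>\<^bsub>L \<times>\<times> T\<^esub>}"
    proof (intro equalityI subsetI)
      fix p assume "p \<in> kernel (L \<times>\<times> T) K h"
      then obtain x y where p: "p = (a x, y)" "x \<in> carrier H" "y \<in> carrier T" "a x \<otimes>\<^bsub>K\<^esub> b y = \<one>\<^bsub>K\<^esub>"
        unfolding kernel_def L_def h_def by auto
      then have "y = \<one>\<^bsub>T\<^esub>" using ker_f by blast
      then show "p \<in> {\<one>\<^bsub>L \<times>\<times> T\<^esub>}" using p by (simp add: L_def)
    next
      fix p assume "p \<in> {\<one>\<^bsub>L \<times>\<times> T\<^esub>}"
      then show "p \<in> kernel (L \<times>\<times> T) K h"
        using monoid.one_closed[OF group.is_monoid[OF DirProd_group[OF L(1) T.is_group]]] by (auto simp: kernel_def h_def L_def)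
    qed
    have "h ` carrier (L \<times>\<times> T) = carrier K"
    proof (intro equalityI subsetI)
      fix z assume "z \<in> carrier K"
      then obtain x y where "x \<in> carrier H" "y \<in> carrier T" "z = f (x, y)" using surj by blast
      then have "z = h (a x, y)" "(a x, y) \<in> carrier (L \<times>\<times> T)" using f_eq by (auto simp: h_def L_def)
      then show "z \<in> h ` carrier (L \<times>\<times> T)" by blast
    qed (use h_hom in \<open>auto simp: hom_def\<close>)
    then have "L \<times>\<times> T \<cong> K"
      using iso_kernel_image[OF DirProd_group[OF L(1) T.is_group] gK] h_hom ker_h is_isoI by blast
    then have "K \<cong> L \<times>\<times> T"
      using iso_symmetric DirProd_group[OF L(1) T.is_group] by blast
    then show ?thesis using prod product_with_simples_iso by blast
  qed
qed

text \<open>\<open>R\<close> is fixed inside the rule and so lives on a single type, that of an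
  abelian group times a \<open>product_group\<close>. Since \<open>D \<times>\<times> T\<close> has
  another type, the step passes to any \<open>D'\<close> of the right type isomorphic to it.\<close>

lemma product_group_simples_induct [consumes 3, case_names comm simple]:
  fixes S :: "nat \<Rightarrow> nat monoid"
  assumes A: "comm_group A" "finite (carrier A)"
    and S: "\<forall>i<k. simple_group (S i) \<and> finite (carrier (S i)) \<and> \<not> comm_group (S i)"
    and comm: "\<And>D :: (nat \<times> (nat \<Rightarrow> nat)) monoid. comm_group D \<Longrightarrow> finite (carrier D) \<Longrightarrow> R D"
    and simple: "\<And>(D :: (nat \<times> (nat \<Rightarrow> nat)) monoid) D' (T :: nat monoid).
      \<lbrakk>group D; finite (carrier D); R D; simple_group T; finite (carrier T); \<not> comm_group T;
       group D'; D' \<cong> D \<times>\<times> T\<rbrakk> \<Longrightarrow> R D'"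
  shows "R (A \<times>\<times> product_group {..<k} S)"
  using S
proof (induction k)
  case 0
  interpret A: comm_group A by fact
  have gE: "group (product_group {..<0::nat} S)" by (rule product_group) simp
  moreover have "carrier (product_group {..<0::nat} S) = {\<one>\<^bsub>product_group {..<0} S\<^esub>}"
    by (simp add: restrict_def)
  ultimately have "comm_group (product_group {..<0::nat} S)" by (rule trivial_comm_group)
  then show ?case
    using A comm_group_DirProd by (intro comm) auto
next
  case (Suc k)
  let ?P = "product_group {..<k} S"
  have grp: "group (S i)" if "i < Suc k" for i
    using Suc.prems simple_group.axioms(1) that by blast
  have gA: "group A" using A(1) by (rule comm_group.axioms(2))
  have gP: "group ?P" "group (product_group {..<Suc k} S)"
    by (rule product_group; use grp in simp)+
  have "A \<times>\<times> product_group {..<Suc k} S \<cong> A \<times>\<times> (?P \<times>\<times> S k)"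
    using group.DirProd_iso_trans[OF gA iso_refl] product_group_Suc_iso by blast
  also have "\<dots> \<cong> (A \<times>\<times> ?P) \<times>\<times> S k" by (rule DirProd_assoc_left_iso)
  finally have iso: "A \<times>\<times> product_group {..<Suc k} S \<cong> (A \<times>\<times> ?P) \<times>\<times> S k" .
  have "finite (carrier (A \<times>\<times> ?P))"
    using A(2) Suc.prems by (auto intro!: finite_PiE)
  then show ?case
    using simple[OF DirProd_group[OF gA gP(1)] _ _ _ _ _ DirProd_group[OF gA gP(2)] iso] Suc by simp
qed

text \<open>The conclusion reaches only an isomorphic copy of \<open>Q\<close> on the fixed type,
  because \<open>Q\<close> may have any type; each use carries the property back to \<open>Q\<close>
  along the isomorphism.\<close>

lemma product_with_simples_induct [consumes 3, case_names comm simple]: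
  assumes Q: "product_with_simples comm_group Q" "group Q" "finite (carrier Q)"
    and comm: "\<And>D :: (nat \<times> (nat \<Rightarrow> nat)) monoid. comm_group D \<Longrightarrow> finite (carrier D) \<Longrightarrow> R D"
    and simple: "\<And>(D :: (nat \<times> (nat \<Rightarrow> nat)) monoid) D' (T :: nat monoid).
      \<lbrakk>group D; finite (carrier D); R D; simple_group T; finite (carrier T); \<not> comm_group T;
       group D'; D' \<cong> D \<times>\<times> T\<rbrakk> \<Longrightarrow> R D'"
  shows "\<exists>D :: (nat \<times> (nat \<Rightarrow> nat)) monoid. group D \<and> Q \<cong> D \<and> R D"
proof -
  obtain A :: "nat monoid" and k and S :: "nat \<Rightarrow> nat monoid" where A: "group A" "comm_group A"
    and S: "\<forall>i<k. simple_group (S i) \<and> finite (carrier (S i)) \<and> \<not> comm_group (S i)"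
    and iso: "Q \<cong> A \<times>\<times> product_group {..<k} S"
    using Q(1) unfolding product_with_simples_def by blast
  have gP: "group (product_group {..<k} S)"
    using S simple_group.axioms(1) by (intro product_group) blast
  \<comment> \<open>Finiteness of the abelian factor is read off from that of the whole product,
    which requires the other factor to be nonempty.\<close>
  have "carrier (product_group {..<k} S) \<noteq> {}"
    using gP by (metis empty_iff group.is_monoid monoid.one_closed)
  moreover have "finite (carrier (A \<times>\<times> product_group {..<k} S))"
    using iso iso_finite Q(3) by blast
  ultimately have "finite (carrier A)"
    unfolding carrier_DirProd using finite_cartesian_productD1 by blast
  then have "R (A \<times>\<times> product_group {..<k} S)"
    using product_group_simples_induct[of A k S R] A(2) S comm simple by blast
  then show ?thesis using iso DirProd_group[OF A(1) gP] by blast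
qed

lemma product_with_simples_epi:
  fixes K :: "('c, 'd) monoid_scheme"
  assumes Q: "product_with_simples comm_group Q" "group Q" "finite (carrier Q)"
    and K: "group K" and f: "f \<in> epi Q K"
  shows "product_with_simples comm_group K"
proof -
  \<comment> \<open>The induction property ranges over all images, because the step from
    \<open>D\<close> to \<open>D \<times>\<times> T\<close> applies it to images of \<open>D\<close>
    other than the given \<open>K\<close>.\<close>
  have "\<exists>D :: (nat \<times> (nat \<Rightarrow> nat)) monoid. group D \<and> Q \<cong> D \<and>
    (\<forall>(K :: ('c, 'd) monoid_scheme) g. group K \<longrightarrow> finite (carrier K) \<longrightarrow> g \<in> epi D K \<longrightarrow>
      product_with_simples comm_group K)"
    using Q
  proof (induction rule: product_with_simples_induct)
    case (comm D)
    then show ?case using comm_group_epi product_with_simples_comm_group by blast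
  next
    case (simple D D' T)
    show ?case
    proof (intro allI impI)
      fix K :: "('c, 'd) monoid_scheme" and g
      assume K: "group K" "finite (carrier K)" and g: "g \<in> epi D' K"
      obtain h where "h \<in> epi (D \<times>\<times> T) D'"
        using simple iso_symmetric epi_of_iso by blast
      then have gh: "g \<circ> h \<in> epi (D \<times>\<times> T) K" using g epi_compose by blast
      show "product_with_simples comm_group K"
        by (rule product_with_simples_epi_DirProd_simple[OF simple(1) K simple(4-6) gh])
           (use simple(3) in blast)
    qed
  qed
  then obtain D :: "(nat \<times> (nat \<Rightarrow> nat)) monoid" where D: "Q \<cong> D"
    "\<And>(K :: ('c, 'd) monoid_scheme) g. group K \<Longrightarrow> finite (carrier K) \<Longrightarrow> g \<in> epi D K \<Longrightarrow>
      product_with_simples comm_group K"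
    by blast
  obtain h where "h \<in> epi D Q"
    using D iso_symmetric[OF Q(2)] epi_of_iso by blast
  then have "f \<circ> h \<in> epi D K" using f epi_compose by blast
  moreover have "finite (carrier K)" using epi_finite f Q(3) by blast
  ultimately show ?thesis using D K by blast
qed

text \<open>Induction on \<open>G\<close>: a simple factor of \<open>G\<close> is moved past
  \<open>B\<close> to the outside, and in the base case both groups are abelian.\<close>

lemma product_with_simples_DirProd_comm:
  assumes G: "product_with_simples comm_group G" "group G" "finite (carrier G)"
    and B: "comm_group B" "finite (carrier B)"
  shows "product_with_simples comm_group (G \<times>\<times> B)"
proof -
  have gB: "group B" using B(1) by (rule comm_group.axioms(2))
  have "\<exists>D :: (nat \<times> (nat \<Rightarrow> nat)) monoid. group D \<and> G \<cong> D \<and>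
    product_with_simples comm_group (D \<times>\<times> B)"
    using G
  proof (induction rule: product_with_simples_induct)
    case (comm D)
    then show ?case
      using B comm_group_DirProd product_with_simples_comm_group by (metis carrier_DirProd finite_cartesian_product)
  next
    case (simple D D' T)
    have "D' \<times>\<times> B \<cong> (D \<times>\<times> T) \<times>\<times> B"
      using simple group.DirProd_iso_trans iso_refl by blast
    also have "\<dots> \<cong> (D \<times>\<times> B) \<times>\<times> T" by (rule DirProd_swap_inner_iso)
    finally have "D' \<times>\<times> B \<cong> (D \<times>\<times> B) \<times>\<times> T" .
    moreover have "product_with_simples comm_group ((D \<times>\<times> B) \<times>\<times> T)"
      using product_with_simples_DirProd_simple[OF simple(3) DirProd_group[OF simple(1) gB] simple(4-6)] .
    ultimately show ?case by (rule product_with_simples_iso)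
  qed
  then show ?thesis
    using group.DirProd_iso_trans[OF G(2) _ iso_refl] product_with_simples_iso by blast
qed

text \<open>Induction on \<open>H\<close>, with the product by an abelian group as base case; each
  simple factor of \<open>H\<close> is regrouped to the outside.\<close>

lemma product_with_simples_DirProd:
  assumes G: "product_with_simples comm_group G" "group G" "finite (carrier G)"
    and H: "product_with_simples comm_group H" "group H" "finite (carrier H)"
  shows "product_with_simples comm_group (G \<times>\<times> H)"
proof -
  have "\<exists>D :: (nat \<times> (nat \<Rightarrow> nat)) monoid. group D \<and> H \<cong> D \<and>
    product_with_simples comm_group (G \<times>\<times> D)"
    using H
  proof (induction rule: product_with_simples_induct)
    case (comm D)
    then show ?case using product_with_simples_DirProd_comm G by blast
  next
    case (simple D D' T)
    have "G \<times>\<times> D' \<cong> G \<times>\<times> (D \<times>\<times> T)"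
      using simple group.DirProd_iso_trans[OF G(2) iso_refl] by blast
    also have "\<dots> \<cong> (G \<times>\<times> D) \<times>\<times> T" by (rule DirProd_assoc_left_iso)
    finally have "G \<times>\<times> D' \<cong> (G \<times>\<times> D) \<times>\<times> T" .
    moreover have "product_with_simples comm_group ((G \<times>\<times> D) \<times>\<times> T)"
      using product_with_simples_DirProd_simple[OF simple(3) DirProd_group[OF G(2) simple(1)] simple(4-6)] .
    ultimately show ?case by (rule product_with_simples_iso)
  qed
  then show ?thesis
    using group.DirProd_iso_trans[OF G(2) iso_refl] product_with_simples_iso by blast
qed

section \<open>Subnormal series with a condition on the quotients\<close>

text \<open>
  Over an arbitrary condition \<open>R\<close> on the quotients, this covers both the series in the definition of
  \<open>Der\<close>, \<open>Fit\<close>, \<open>Solv\<close> and those in the constructability axiom; it obeys a recursion in the length.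
\<close>

definition series_by :: "('a set monoid \<Rightarrow> bool) \<Rightarrow> ('a, 'b) monoid_scheme \<Rightarrow> nat \<Rightarrow> bool" where
  "series_by R G n \<longleftrightarrow> (\<exists>s. subnormal_series G s n \<and> (\<forall>i<n. R (series_quotient G s i)))"

lemma series_by_0: "series_by R G 0 \<longleftrightarrow> carrier G = {\<one>\<^bsub>G\<^esub>}"
  unfolding series_by_def subnormal_series_def by auto

text \<open>Series run downward from \<open>s 0 = carrier G\<close>, so the recursion peels off the
  top quotient. Most later arguments use it in place of the functions \<open>s\<close>.\<close>

lemma series_by_Suc:
  fixes G :: "('a, 'b) monoid_scheme"
  shows "series_by R G (Suc n) \<longleftrightarrow> (\<exists>N. N \<lhd> G \<and> R (G Mod N) \<and> series_by R (G\<lparr>carrier := N\<rparr>) n)"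
proof
  assume "series_by R G (Suc n)"
  then obtain s where s: "s 0 = carrier G" "s (Suc n) = {\<one>\<^bsub>G\<^esub>}"
    "\<And>i. i < Suc n \<Longrightarrow> s (Suc i) \<lhd> G\<lparr>carrier := s i\<rparr>"
    "\<And>i. i < Suc n \<Longrightarrow> R (series_quotient G s i)"
    unfolding series_by_def subnormal_series_def by blast
  have "s (Suc 0) \<lhd> G" "R (G Mod s (Suc 0))"
    using s(1) s(3)[of 0] s(4)[of 0] by auto
  moreover have "subnormal_series (G\<lparr>carrier := s (Suc 0)\<rparr>) (\<lambda>i. s (Suc i)) n"
    using s unfolding subnormal_series_def by simp
  ultimately show "\<exists>N. N \<lhd> G \<and> R (G Mod N) \<and> series_by R (G\<lparr>carrier := N\<rparr>) n"
    using s(4) unfolding series_by_def by (intro exI[of _ "s (Suc 0)"]) auto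
next
  assume "\<exists>N. N \<lhd> G \<and> R (G Mod N) \<and> series_by R (G\<lparr>carrier := N\<rparr>) n"
  then obtain N t where N: "N \<lhd> G" "R (G Mod N)"
    and t: "t 0 = N" "t n = {\<one>\<^bsub>G\<^esub>}" "\<And>i. i < n \<Longrightarrow> t (Suc i) \<lhd> G\<lparr>carrier := t i\<rparr>"
      "\<And>i. i < n \<Longrightarrow> R (series_quotient G t i)"
    unfolding series_by_def subnormal_series_def by auto
  \<comment> \<open>\<open>G\<close> is prepended to the series of \<open>N\<close>, shifting the
    indices by one.\<close>
  define s where "s = case_nat (carrier G) t"
  have "s (Suc i) \<lhd> G\<lparr>carrier := s i\<rparr> \<and> R (series_quotient G s i)" if "i < Suc n" for i
    using that N t by (cases i) (auto simp: s_def)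
  then show "series_by R G (Suc n)"
    unfolding series_by_def subnormal_series_def using t(2)
    by (intro exI[of _ s]) (auto simp: s_def)
qed

section \<open>Images and preimages of normal subgroups\<close>

lemma normal_subgroup_group: "N \<lhd> G \<Longrightarrow> group (G\<lparr>carrier := N\<rparr>)"
  by (simp add: normal_def subgroup.subgroup_is_group)

lemma normal_finite: "N \<lhd> G \<Longrightarrow> finite (carrier G) \<Longrightarrow> finite N"
  by (meson finite_subset normal_imp_subgroup subgroup.subset)

lemma finite_Mod: "finite (carrier G) \<Longrightarrow> finite (carrier (G Mod N))"
  by (simp add: carrier_FactGroup)

lemma quotient_map_epi: "N \<lhd> G \<Longrightarrow> (\<lambda>x. N #>\<^bsub>G\<^esub> x) \<in> epi G (G Mod N)"
  using normal.r_coset_hom_Mod by (auto simp: epi_def carrier_FactGroup)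

lemma quotient_map_kernel: "N \<lhd> G \<Longrightarrow> x \<in> carrier G \<Longrightarrow> N #>\<^bsub>G\<^esub> x = N \<longleftrightarrow> x \<in> N"
  by (meson group.coset_join1 group.coset_join2 normal.axioms(2) normal_imp_subgroup)

text \<open>The composite of \<open>f\<close> with the quotient map of \<open>H\<close> kills
  \<open>N\<close>, hence factors through \<open>G Mod N\<close>; the induced map stays
  surjective.\<close>

lemma epi_Mod:
  assumes "group G" "group H" "f \<in> epi G H" "N \<lhd> G"
  shows "f ` N \<lhd> H" "\<exists>g. g \<in> epi (G Mod N) (H Mod f ` N)"
proof -
  interpret f: group_hom G H f using assms by (intro epi_group_hom)
  show M: "f ` N \<lhd> H"
    using normal.surj_hom_normal_subgroup[OF assms(4) f.group_hom_axioms] assms(3) by (simp add: epi_def)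
  let ?q = "(\<lambda>y. f ` N #>\<^bsub>H\<^esub> y) \<circ> f"
  have q: "?q \<in> epi G (H Mod f ` N)"
    using epi_compose[OF assms(3) quotient_map_epi[OF M]] .
  interpret q: group_hom G "H Mod f ` N" ?q
    by (rule epi_group_hom[OF q assms(1) normal.factorgroup_is_group[OF M]])
  have "N \<subseteq> carrier G" using assms(4) by (meson normal_imp_subgroup subgroup.subset)
  then have "N \<subseteq> kernel G (H Mod f ` N) ?q"
    using quotient_map_kernel[OF M] by (auto simp: kernel_def subset_iff)
  then obtain g where g: "g \<in> hom (G Mod N) (H Mod f ` N)" "\<And>x. x \<in> carrier G \<Longrightarrow> g (N #>\<^bsub>G\<^esub> x) = ?q x"
    using q.FactGroup_universal_kernel[OF assms(4)] by blast
  have "g ` carrier (G Mod N) = ?q ` carrier G"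
    using g(2) unfolding carrier_FactGroup image_image by (intro image_cong) auto
  then show "\<exists>g. g \<in> epi (G Mod N) (H Mod f ` N)"
    using g(1) q unfolding epi_def by auto
qed

text \<open>\<open>L\<close> is the kernel of the composite from \<open>G\<close> through
  \<open>H\<close> to \<open>H Mod M\<close>, so the first isomorphism theorem applies.\<close>

lemma preimage_normal:
  assumes "group G" "group H" "f \<in> epi G H" "M \<lhd> H"
  defines "L \<equiv> {x \<in> carrier G. f x \<in> M}"
  shows "L \<lhd> G" "G Mod L \<cong> H Mod M"
proof -
  let ?q = "(\<lambda>y. M #>\<^bsub>H\<^esub> y) \<circ> f"
  have q: "?q \<in> epi G (H Mod M)"
    using epi_compose[OF assms(3) quotient_map_epi[OF assms(4)]] .
  interpret q: group_hom G "H Mod M" ?q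
    by (rule epi_group_hom[OF q assms(1) normal.factorgroup_is_group[OF assms(4)]])
  have "f x \<in> carrier H" if "x \<in> carrier G" for x
    using assms(3) that unfolding epi_def by blast
  then have "kernel G (H Mod M) ?q = L"
    using quotient_map_kernel[OF assms(4)] by (auto simp: kernel_def L_def)
  then show "L \<lhd> G" "G Mod L \<cong> H Mod M"
    using q.normal_kernel q.FactGroup_iso q by (auto simp: epi_def)
qed

section \<open>Closure properties of the series that define \<open>Der\<close>\<close>

abbreviation abelian_simple_series :: "('a, 'b) monoid_scheme \<Rightarrow> nat \<Rightarrow> bool" where
  "abelian_simple_series \<equiv> series_by (product_with_simples comm_group)"

text \<open>The images of the terms under \<open>f\<close> form a series of \<open>H\<close>, whose
  quotients are epimorphic images of the old ones.\<close>

lemma abelian_simple_series_epi: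
  assumes "abelian_simple_series G n" "group G" "finite (carrier G)" "group H" "f \<in> epi G H"
  shows "abelian_simple_series H n"
  using assms
proof (induction n arbitrary: G H)
  case 0
  then show ?case
    using hom_one unfolding series_by_0 epi_def by fastforce
next
  case (Suc n)
  then obtain N where N: "N \<lhd> G" "product_with_simples comm_group (G Mod N)"
    "abelian_simple_series (G\<lparr>carrier := N\<rparr>) n"
    unfolding series_by_Suc by blast
  note M = epi_Mod[OF Suc.prems(2,4,5) N(1)]
  obtain g where g: "g \<in> epi (G Mod N) (H Mod f ` N)" using M(2) by (elim exE)
  have "product_with_simples comm_group (H Mod f ` N)"
    by (rule product_with_simples_epi[OF N(2) normal.factorgroup_is_group[OF N(1)]
          finite_Mod[OF Suc.prems(3)] normal.factorgroup_is_group[OF M(1)] g])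
  moreover have "f \<in> epi (G\<lparr>carrier := N\<rparr>) (H\<lparr>carrier := f ` N\<rparr>)"
    using Suc.prems(5) subgroup.subset[OF normal_imp_subgroup[OF N(1)]]
    by (auto simp: epi_def hom_def subset_iff)
  then have "abelian_simple_series (H\<lparr>carrier := f ` N\<rparr>) n"
    using Suc.IH[OF N(3) normal_subgroup_group[OF N(1)] _ normal_subgroup_group[OF M(1)]]
      normal_finite[OF N(1) Suc.prems(3)] by simp
  ultimately show ?case using M(1) unfolding series_by_Suc by blast
qed

text \<open>The series of \<open>H\<close> is pulled back along \<open>f\<close> and continued
  inside the kernel. Using \<open>f\<close> in place of \<open>G Mod N\<close> suits the induction
  on \<open>m\<close>: restricted to the preimage of a term, \<open>f\<close> is again an
  epimorphism with the same kernel.\<close>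

lemma abelian_simple_series_extension:
  assumes "abelian_simple_series H m" "abelian_simple_series (G\<lparr>carrier := kernel G H f\<rparr>) n"
    "group G" "finite (carrier G)" "group H" "f \<in> epi G H"
  shows "abelian_simple_series G (m + n)"
  using assms
proof (induction m arbitrary: G H)
  case 0
  \<comment> \<open>Here \<open>H\<close> is trivial, so the kernel is all of
    \<open>G\<close>.\<close>
  then have "f x = \<one>\<^bsub>H\<^esub>" if "x \<in> carrier G" for x
    using that unfolding series_by_0 epi_def by blast
  then have "kernel G H f = carrier G" by (auto simp: kernel_def)
  then show ?case using 0 by simp
next
  case (Suc m)
  then obtain M where M: "M \<lhd> H" "product_with_simples comm_group (H Mod M)"
    "abelian_simple_series (H\<lparr>carrier := M\<rparr>) m"
    unfolding series_by_Suc by blast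
  define L where "L = {x \<in> carrier G. f x \<in> M}"
  have L: "L \<lhd> G" "G Mod L \<cong> H Mod M"
    using preimage_normal[OF Suc.prems(3,5,6) M(1)] by (simp_all add: L_def)
  have sub: "M \<subseteq> carrier H" "\<one>\<^bsub>H\<^esub> \<in> M"
    using normal_imp_subgroup[OF M(1)] by (auto simp: subgroup.subset subgroup.one_closed)
  have "f ` L = M"
  proof (intro equalityI subsetI)
    fix y assume "y \<in> M"
    then have "y \<in> f ` carrier G" using Suc.prems(6) sub(1) by (auto simp: epi_def)
    then show "y \<in> f ` L" using \<open>y \<in> M\<close> by (auto simp: L_def)
  qed (auto simp: L_def)
  then have f: "f \<in> epi (G\<lparr>carrier := L\<rparr>) (H\<lparr>carrier := M\<rparr>)"
    using Suc.prems(6) unfolding epi_def hom_def by (auto simp: L_def)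
  have "kernel (G\<lparr>carrier := L\<rparr>) (H\<lparr>carrier := M\<rparr>) f = kernel G H f"
    using sub(2) by (auto simp: kernel_def L_def)
  then have "abelian_simple_series (G\<lparr>carrier := L, carrier := kernel (G\<lparr>carrier := L\<rparr>) (H\<lparr>carrier := M\<rparr>) f\<rparr>) n"
    using Suc.prems(2) by simp
  then have "abelian_simple_series (G\<lparr>carrier := L\<rparr>) (m + n)"
    using Suc.IH[OF M(3) _ normal_subgroup_group[OF L(1)] _ normal_subgroup_group[OF M(1)] f]
      normal_finite[OF L(1) Suc.prems(4)] by simp
  moreover have "product_with_simples comm_group (G Mod L)"
    by (rule product_with_simples_iso[OF L(2) M(2)])
  ultimately show ?case using L(1) unfolding add_Suc series_by_Suc by blast
qed

text \<open>The terms of the two series are multiplied index by index; the quotient of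
  \<open>H \<times>\<times> K\<close> by \<open>N \<times> M\<close> splits as the product of the
  two quotients.\<close>

lemma abelian_simple_series_DirProd:
  assumes "abelian_simple_series H n" "abelian_simple_series K n"
    "group H" "finite (carrier H)" "group K" "finite (carrier K)"
  shows "abelian_simple_series (H \<times>\<times> K) n"
  using assms
proof (induction n arbitrary: H K)
  case 0
  then show ?case unfolding series_by_0 by simp
next
  case (Suc n)
  obtain N where N: "N \<lhd> H" "product_with_simples comm_group (H Mod N)"
    "abelian_simple_series (H\<lparr>carrier := N\<rparr>) n"
    using Suc.prems(1) unfolding series_by_Suc by blast
  obtain M where M: "M \<lhd> K" "product_with_simples comm_group (K Mod M)"
    "abelian_simple_series (K\<lparr>carrier := M\<rparr>) n"
    using Suc.prems(2) unfolding series_by_Suc by blast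
  have "N \<times> M \<lhd> H \<times>\<times> K"
    by (rule group.DirProd_normal[OF Suc.prems(3,5) N(1) M(1)])
  moreover have "product_with_simples comm_group ((H Mod N) \<times>\<times> (K Mod M))"
    by (rule product_with_simples_DirProd[OF
          N(2) normal.factorgroup_is_group[OF N(1)] finite_Mod[OF Suc.prems(4)]
          M(2) normal.factorgroup_is_group[OF M(1)] finite_Mod[OF Suc.prems(6)]])
  then have "product_with_simples comm_group (H \<times>\<times> K Mod N \<times> M)"
    by (rule product_with_simples_iso[OF
          group.FactGroup_DirProd_multiplication_iso_2[OF Suc.prems(3,5) N(1) M(1)]])
  moreover have "abelian_simple_series (H\<lparr>carrier := N\<rparr> \<times>\<times> K\<lparr>carrier := M\<rparr>) n"
    using Suc.IH[OF N(3) M(3) normal_subgroup_group[OF N(1)] _ normal_subgroup_group[OF M(1)]]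
      normal_finite[OF N(1) Suc.prems(4)] normal_finite[OF M(1) Suc.prems(6)] by simp
  then have "abelian_simple_series ((H \<times>\<times> K)\<lparr>carrier := N \<times> M\<rparr>) n"
    by (simp add: DirProd_def)
  ultimately show ?case unfolding series_by_Suc by blast
qed

text \<open>The whole group is repeated at the top, which inserts a trivial quotient; this brings
  two series to the same length.\<close>

lemma abelian_simple_series_mono:
  assumes "abelian_simple_series G m" "m \<le> n" "group G" "finite (carrier G)"
  shows "abelian_simple_series G n"
  using assms(2)
proof (induction rule: dec_induct)
  case (step n)
  interpret G: group G by fact
  have "carrier G \<lhd> G" by (rule G.normal_self)
  have "carrier (G Mod carrier G) = {\<one>\<^bsub>G Mod carrier G\<^esub>}"
    using G.coset_join2[OF _ G.subgroup_self] by (auto simp: carrier_FactGroup)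
  then have "product_with_simples comm_group (G Mod carrier G)"
    by (intro product_with_simples_comm_group trivial_comm_group
        normal.factorgroup_is_group[OF G.normal_self] finite_Mod assms(4))
  then show ?case using step.IH G.normal_self unfolding series_by_Suc by (intro exI[of _ "carrier G"]) simp
qed (fact assms(1))

lemma (in group) trivial_Mod_iso: "G Mod {\<one>} \<cong> G"
  using trivial_factor_iso is_isoI by blast

lemma (in group) abelian_simple_series_one:
  assumes "product_with_simples comm_group G"
  shows "abelian_simple_series G 1"
proof -
  have "product_with_simples comm_group (G Mod {\<one>})"
    by (rule product_with_simples_iso[OF trivial_Mod_iso assms])
  moreover have "series_by R (G\<lparr>carrier := {\<one>}\<rparr>) 0" for R by (simp add: series_by_0)
  ultimately show ?thesis using one_is_normal unfolding One_nat_def series_by_Suc by blast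
qed

lemma abelian_simple_series_iso:
  "\<lbrakk>abelian_simple_series G n; G \<cong> H; group G; finite (carrier G); group H\<rbrakk> \<Longrightarrow> abelian_simple_series H n"
  using abelian_simple_series_epi epi_of_iso by blast

section \<open>Existence of such series\<close>

text \<open>Induction on the order: a simple group needs one step, and otherwise series of a proper
  nontrivial normal subgroup and of its quotient are concatenated. The induction must stay within
  one type, hence the naturals.\<close>

lemma abelian_simple_series_exists_nat:
  fixes G :: "nat monoid"
  assumes "group G" "finite (carrier G)"
  shows "\<exists>n. abelian_simple_series G n"
  using assms
proof (induction "card (carrier G)" arbitrary: G rule: less_induct)
  case less
  interpret G: group G by fact
  consider "carrier G = {\<one>\<^bsub>G\<^esub>}" | "simple_group G" | N where "N \<lhd> G" "N \<noteq> carrier G" "N \<noteq> {\<one>\<^bsub>G\<^esub>}"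
      "carrier G \<noteq> {\<one>\<^bsub>G\<^esub>}"
  proof (cases "carrier G = {\<one>\<^bsub>G\<^esub>}")
    case False
    then have "order G \<noteq> 1" unfolding order_def using G.one_closed by (metis card_1_singletonE singletonD)
    moreover have "order G > 0" using less.prems G.order_gt_0_iff_finite by blast
    ultimately have "1 < order G" by linarith
    then have "simple_group G" if "\<And>N. N \<lhd> G \<Longrightarrow> N = carrier G \<or> N = {\<one>\<^bsub>G\<^esub>}"
      using that G.is_group by (simp add: simple_group_def simple_group_axioms_def)
    then show thesis using that False by blast
  qed
  then show ?case
  proof cases
    case 1
    then show ?thesis using series_by_0 by blast
  next
    case 2
    then show ?thesis using product_with_simples_simple G.abelian_simple_series_one less.prems by blast
  next
    case 3
    note N = this
    have sub: "subgroup N G" using N(1) by (rule normal_imp_subgroup)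
    have fin: "finite N" using normal_finite N(1) less.prems by blast
    have "N \<subset> carrier G" using subgroup.subset[OF sub] N(2) by blast
    then have "card N < card (carrier G)" using less.prems psubset_card_mono by blast
    then obtain n where n: "abelian_simple_series (G\<lparr>carrier := N\<rparr>) n"
      using less.hyps[of "G\<lparr>carrier := N\<rparr>"] normal_subgroup_group[OF N(1)] fin by auto
    \<comment> \<open>\<open>G Mod N\<close> consists of sets of naturals, so the induction
      hypothesis is applied to a copy.\<close>
    define Q where "Q = nat_copy (G Mod N)"
    have gM: "group (G Mod N)" using N(1) by (rule normal.factorgroup_is_group)
    have finM: "finite (carrier (G Mod N))" using finite_Mod less.prems by blast
    have Q: "group Q" "finite (carrier Q)" "G Mod N \<cong> Q"
      using nat_copy[OF gM finM] by (auto simp: Q_def)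
    \<comment> \<open>By Lagrange the quotient is smaller than \<open>G\<close> because
      \<open>N\<close> has more than one element.\<close>
    have "card N \<noteq> 1" using N(3) subgroup.one_closed[OF sub] by (metis card_1_singletonE singletonD)
    moreover have "card N > 0" using fin subgroup.one_closed[OF sub] card_gt_0_iff by blast
    moreover have "card (carrier (G Mod N)) * card N = card (carrier G)"
      using G.lagrange[OF sub] by (simp add: FactGroup_def order_def)
    moreover have "card (carrier G) > 0" using less.prems G.one_closed card_gt_0_iff by blast
    ultimately have "card (carrier (G Mod N)) < card (carrier G)"
      by (metis One_nat_def Suc_lessI mult_0 n_less_m_mult_n neq0_conv mult.commute)
    then obtain m where "abelian_simple_series Q m"
      using less.hyps[of Q] Q iso_same_card by metis
    then have m: "abelian_simple_series (G Mod N) m"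
      using abelian_simple_series_iso[OF _ iso_symmetric[OF gM Q(3)] Q(1,2) gM] by blast
    have "kernel G (G Mod N) (\<lambda>x. N #>\<^bsub>G\<^esub> x) = N"
      using quotient_map_kernel[OF N(1)] subgroup.subset[OF sub] by (auto simp: kernel_def)
    then show ?thesis
      using abelian_simple_series_extension[OF m _ G.is_group less.prems(2) gM quotient_map_epi[OF N(1)]] n by auto
  qed
qed

lemma abelian_simple_series_exists:
  assumes "group G" "finite (carrier G)"
  shows "\<exists>n. abelian_simple_series G n"
  using nat_copy[OF assms] abelian_simple_series_exists_nat abelian_simple_series_iso iso_symmetric assms by metis

section \<open>\<open>Der\<close> is a complexity function\<close>

lemma shortest_series_eq: "shortest_series P G = (LEAST n. series_by (product_with_simples P) G n)"
  unfolding shortest_series_def series_by_def ..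

lemma Der_series: "group G \<Longrightarrow> finite (carrier G) \<Longrightarrow> abelian_simple_series G (Der G)"
  unfolding Der_def shortest_series_eq using abelian_simple_series_exists LeastI_ex by metis

lemma Der_le: "abelian_simple_series G n \<Longrightarrow> Der G \<le> n"
  unfolding Der_def shortest_series_eq by (rule Least_le)

lemma Der_epi: "group G \<Longrightarrow> finite (carrier G) \<Longrightarrow> group H \<Longrightarrow> f \<in> epi G H \<Longrightarrow> Der H \<le> Der G"
  using Der_le Der_series abelian_simple_series_epi by blast

lemma Der_iso: "group G \<Longrightarrow> finite (carrier G) \<Longrightarrow> group H \<Longrightarrow> G \<cong> H \<Longrightarrow> Der G = Der H"
  using Der_epi epi_of_iso iso_symmetric iso_finite by (metis le_antisym)

text \<open>\<open>Der\<close> is polymorphic: on the left it is the instance on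
  \<open>nat monoid\<close>, evaluated at a copy of \<open>G\<close>, and on the right the instance
  at the type of \<open>G\<close>.\<close>

lemma at_group_Der: "group G \<Longrightarrow> finite (carrier G) \<Longrightarrow> at_group Der G = Der G"
  unfolding at_group_def using nat_copy Der_iso by metis

text \<open>The axioms are closure properties of the series: concatenation, images, products, and
  length 0 for the trivial group. Constructability holds since a shortest series itself has
  quotients with \<open>Der\<close> at most 1.\<close>

lemma Der_complexity_function: "complexity_function Der"
  unfolding complexity_function_def
proof (intro conjI)
  show "extension_axiom Der"
    unfolding extension_axiom_def
  proof (intro allI impI, elim conjE)
    fix G :: "nat monoid" and N assume G: "group G" "finite (carrier G)" and N: "N \<lhd> G"
    have gM: "group (G Mod N)" "finite (carrier (G Mod N))"
      by (simp_all add: normal.factorgroup_is_group[OF N] finite_Mod[OF G(2)])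
    have "kernel G (G Mod N) (\<lambda>x. N #>\<^bsub>G\<^esub> x) = N"
      using quotient_map_kernel[OF N] subgroup.subset[OF normal_imp_subgroup[OF N]] by (auto simp: kernel_def)
    moreover have "abelian_simple_series (G\<lparr>carrier := N\<rparr>) (Der (G\<lparr>carrier := N\<rparr>))"
      using Der_series[OF normal_subgroup_group[OF N]] normal_finite[OF N G(2)] by simp
    ultimately have "abelian_simple_series G (Der (G Mod N) + Der (G\<lparr>carrier := N\<rparr>))"
      using abelian_simple_series_extension[OF Der_series[OF gM] _ G gM(1) quotient_map_epi[OF N]] by simp
    then show "Der G \<le> Der (G\<lparr>carrier := N\<rparr>) + at_group Der (G Mod N)"
      using Der_le at_group_Der[OF gM] by (simp add: add.commute)
  qed
  show "quotient_axiom Der"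
    unfolding quotient_axiom_def using Der_epi by blast
  show "constructability_axiom Der"
    unfolding constructability_axiom_def series_by_def[symmetric]
  proof (intro allI impI, elim conjE)
    fix G :: "nat monoid" assume G: "group G" "finite (carrier G)"
    have "series_by (\<lambda>Q. at_group Der Q \<le> 1) G n" if "abelian_simple_series G n" "group G" "finite (carrier G)"
      for G :: "nat monoid" and n
      using that
    proof (induction n arbitrary: G)
      case 0
      then show ?case by (simp add: series_by_0)
    next
      case (Suc n)
      then obtain N where N: "N \<lhd> G" "product_with_simples comm_group (G Mod N)"
        "abelian_simple_series (G\<lparr>carrier := N\<rparr>) n"
        unfolding series_by_Suc by blast
      have gM: "group (G Mod N)" "finite (carrier (G Mod N))"
        by (simp_all add: normal.factorgroup_is_group[OF N(1)] finite_Mod[OF Suc.prems(3)])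
      have "at_group Der (G Mod N) \<le> 1"
        using at_group_Der[OF gM] Der_le group.abelian_simple_series_one[OF gM(1) N(2)] by metis
      moreover have "series_by (\<lambda>Q. at_group Der Q \<le> 1) (G\<lparr>carrier := N\<rparr>) n"
        using Suc.IH[OF N(3) normal_subgroup_group[OF N(1)]] normal_finite[OF N(1) Suc.prems(3)] by simp
      ultimately show ?case using N(1) unfolding series_by_Suc by blast
    qed
    then show "\<exists>s n. subnormal_series G s n \<and> (\<forall>i<n. at_group Der (series_quotient G s i) \<le> 1)"
      using Der_series[OF G] G unfolding series_by_def by blast
  qed
  show "product_axiom Der"
    unfolding product_axiom_def
  proof (intro allI impI, elim conjE)
    fix H K :: "nat monoid"
    assume H: "group H" "finite (carrier H)" and K: "group K" "finite (carrier K)"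
    have HK: "group (H \<times>\<times> K)" "finite (carrier (H \<times>\<times> K))"
      using DirProd_group H K by auto
    \<comment> \<open>The shorter of the two series is padded to the common length.\<close>
    have "abelian_simple_series (H \<times>\<times> K) (max (Der H) (Der K))"
      by (intro abelian_simple_series_DirProd H K
          abelian_simple_series_mono[OF Der_series[OF H] max.cobounded1 H]
          abelian_simple_series_mono[OF Der_series[OF K] max.cobounded2 K])
    \<comment> \<open>The projections give the reverse inequality.\<close>
    moreover have "fst \<in> epi (H \<times>\<times> K) H" "snd \<in> epi (H \<times>\<times> K) K"
      using H K group.is_monoid monoid.one_closed by (fastforce simp: epi_def hom_def image_iff)+
    then have "Der H \<le> Der (H \<times>\<times> K)" "Der K \<le> Der (H \<times>\<times> K)"
      using Der_epi HK H K by blast+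
    ultimately show "at_group Der (H \<times>\<times> K) = max (Der H) (Der K)"
      using at_group_Der[OF HK] Der_le by (metis le_antisym max.bounded_iff)
  qed
  show "initial_condition Der"
    unfolding initial_condition_def using Der_le[of _ 0] by (auto simp: series_by_0)
qed

section \<open>Boundedness of complexity functions and comparison with \<open>cx\<close>\<close>

text \<open>Each proper step of a series given by constructability lowers the order and adds at most
  1 to \<open>c\<close>. The bound is crude but uniform in \<open>c\<close>, as the supremum in
  \<open>cx\<close> requires.\<close>

lemma complexity_function_le_card:
  fixes G :: "nat monoid"
  assumes c: "complexity_function c" and G: "group G" "finite (carrier G)"
  shows "c G \<le> card (carrier G)"
proof -
  obtain n where "series_by (\<lambda>Q. at_group c Q \<le> 1) G n"
    using c G unfolding complexity_function_def constructability_axiom_def series_by_def by blast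
  then show ?thesis using G
  proof (induction n arbitrary: G)
    case 0
    then show ?case
      using c unfolding complexity_function_def initial_condition_def series_by_0 by simp
  next
    case (Suc n)
    then obtain N where N: "N \<lhd> G" "at_group c (G Mod N) \<le> 1"
      "series_by (\<lambda>Q. at_group c Q \<le> 1) (G\<lparr>carrier := N\<rparr>) n"
      unfolding series_by_Suc by blast
    have IH: "c (G\<lparr>carrier := N\<rparr>) \<le> card N"
      using Suc.IH[OF N(3) normal_subgroup_group[OF N(1)]] normal_finite[OF N(1) Suc.prems(3)] by simp
    show ?case
    proof (cases "N = carrier G")
      \<comment> \<open>For a repeated term, \<open>N\<close> is all of \<open>G\<close>, so the
        bound for \<open>N\<close> is already the one wanted.\<close>
      case True
      then show ?thesis using IH by simp
    next
      case False
      then have "card N < card (carrier G)"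
        using subgroup.subset[OF normal_imp_subgroup[OF N(1)]] Suc.prems(3) by (meson psubsetI psubset_card_mono)
      moreover have "c G \<le> c (G\<lparr>carrier := N\<rparr>) + at_group c (G Mod N)"
        using c N(1) Suc.prems unfolding complexity_function_def extension_axiom_def by blast
      ultimately show ?thesis using IH N(2) by linarith
    qed
  qed
qed

lemma complexity_function_le_cx:
  assumes "complexity_function c" "group G" "finite (carrier G)"
  shows "at_group c G \<le> cx G"
proof -
  have "at_group d G \<le> card (carrier (nat_copy G))" if "complexity_function d" for d
    unfolding at_group_def using nat_copy[OF assms(2,3)] that complexity_function_le_card by blast
  \<comment> \<open>On the naturals \<open>Sup\<close> is known to be an upper bound only for
    bounded sets.\<close>
  then have "bdd_above {at_group c G | c. complexity_function c}"
    by (intro bdd_aboveI) blast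
  then show ?thesis
    unfolding cx_def using assms(1) by (intro cSup_upper) blast
qed

section \<open>Abelian, nilpotent and solvable groups\<close>

text \<open>The derived series takes commutators of two elements of the current term, while the
  lower central series lets one of them range over the whole group.\<close>

lemma (in group) derived_series_subset_lower_central_series:
  "(derived G ^^ n) (carrier G) \<subseteq> lower_central_series G n"
proof (induction n)
  case (Suc n)
  have "(derived G ^^ n) (carrier G) \<subseteq> carrier G"
    using exp_of_derived_in_carrier by blast
  then show ?case
    using Suc unfolding funpow.simps comp_def lower_central_series.simps derived_def
    by (intro mono_generate) blast
qed simp

lemma nilpotent_solvable:
  assumes "group G" "nilpotent G"
  shows "solvable G"
proof -
  interpret group G by fact
  obtain n where "lower_central_series G n = {\<one>\<^bsub>G\<^esub>}"
    using assms(2) unfolding nilpotent_def by blast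
  moreover have "\<one>\<^bsub>G\<^esub> \<in> (derived G ^^ n) (carrier G)"
    using exp_of_derived_is_subgroup[OF subgroup_self] subgroup.one_closed by blast
  ultimately have "(derived G ^^ n) (carrier G) = {\<one>\<^bsub>G\<^esub>}"
    using derived_series_subset_lower_central_series[of n] by blast
  then show ?thesis using solvable_iff_trivial_derived_seq by blast
qed

lemma comm_group_nilpotent:
  assumes "comm_group G"
  shows "nilpotent G"
proof -
  interpret comm_group G by fact
  let ?c = "\<lambda>x y. x \<otimes>\<^bsub>G\<^esub> y \<otimes>\<^bsub>G\<^esub> inv\<^bsub>G\<^esub> x \<otimes>\<^bsub>G\<^esub> inv\<^bsub>G\<^esub> y"
  have c: "?c x y = \<one>\<^bsub>G\<^esub>" if "x \<in> carrier G" "y \<in> carrier G" for x y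
    using that by (metis inv_closed inv_mult m_assoc m_closed r_inv)
  have "(\<Union>x\<in>carrier G. \<Union>y\<in>carrier G. {?c x y}) = (\<Union>x\<in>carrier G. \<Union>y\<in>carrier G. {\<one>\<^bsub>G\<^esub>})"
    by (intro SUP_cong refl) (simp only: c)
  \<comment> \<open>The index set is nonempty, so the union is the trivial subgroup rather than the
    empty set.\<close>
  also have "\<dots> = {\<one>\<^bsub>G\<^esub>}" using one_closed by auto
  finally have "(\<Union>x\<in>carrier G. \<Union>y\<in>carrier G. {?c x y}) = {\<one>\<^bsub>G\<^esub>}" .
  then have "lower_central_series G 1 = {\<one>\<^bsub>G\<^esub>}" using generate_one by simp
  then show ?thesis unfolding nilpotent_def by blast
qed

section \<open>Monotonicity in the condition on the factors\<close>

lemma product_with_simples_mono: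
  assumes "\<And>A. group A \<Longrightarrow> P A \<Longrightarrow> P' A" "product_with_simples P Q"
  shows "product_with_simples P' Q"
  using assms unfolding product_with_simples_def by blast

lemma series_by_mono: "(\<And>Q. R Q \<Longrightarrow> R' Q) \<Longrightarrow> series_by R G n \<Longrightarrow> series_by R' G n"
  unfolding series_by_def by blast

text \<open>A shortest series for \<open>P\<close> is also a series for \<open>P'\<close>. The
  length \<open>n\<close> guarantees that the minimum for \<open>P\<close> is attained.\<close>

lemma shortest_series_antimono:
  assumes "\<And>A. group A \<Longrightarrow> P A \<Longrightarrow> P' A" "series_by (product_with_simples P) G n"
  shows "shortest_series P' G \<le> shortest_series P G"
proof -
  have "series_by (product_with_simples P) G (shortest_series P G)"
    unfolding shortest_series_eq using assms(2) by (rule LeastI)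
  then have "series_by (product_with_simples P') G (shortest_series P G)"
    by (rule series_by_mono[rotated]) (rule product_with_simples_mono[OF assms(1)])
  then show ?thesis unfolding shortest_series_eq[of P'] by (rule Least_le)
qed

theorem theorem6p20:
  fixes G :: "('a, 'b) monoid_scheme"
  assumes "group G" and "finite (carrier G)"
  shows "Solv G \<le> Fit G \<and> Fit G \<le> Der G \<and> Der G \<le> cx G"
proof (intro conjI)
  \<comment> \<open>This one series shows that the minimum for \<open>Der\<close> and, after
    weakening abelian to nilpotent, the one for \<open>Fit\<close> exist.\<close>
  obtain n where Der: "abelian_simple_series G n"
    using abelian_simple_series_exists assms by blast
  then have Fit: "series_by (product_with_simples nilpotent) G n"
    by (rule series_by_mono[rotated]) (rule product_with_simples_mono[OF comm_group_nilpotent])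
  show "Solv G \<le> Fit G"
    unfolding Solv_def Fit_def using nilpotent_solvable Fit by (rule shortest_series_antimono)
  show "Fit G \<le> Der G"
    unfolding Fit_def Der_def using comm_group_nilpotent Der by (rule shortest_series_antimono)
  show "Der G \<le> cx G"
    using complexity_function_le_cx[OF Der_complexity_function assms] at_group_Der[OF assms] by simp
qed

end
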